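(* The operator $K:L^2_V(\mathbb{T})\to L^2_V(\mathbb{T})$ defined by $$Kf(t)=\int_{\mathbb{T}}\varrho_{W,0}(t,s)f(s)\,dV(s),\quad t\in\mathbb{T},\qquad \varrho_{W,0}(t,s)=W(t\wedge s)-\frac{W(t)W(s)}{W(1)},\quad t,s\in[0,1),$$ is trace-class.
   Context: $W,V:\mathbb{R}\to\mathbb{R}$ are strictly increasing, $W$ càdlàg, $V$ càglàd, $W(x+1)-W(x)=W(1)-W(0)$ and $V(x+1)-V(x)=V(1)-V(0)$ for all $x$, both are continuous at $0$ and $W(0)=V(0)=0$. $\mathbb{T}=\mathbb{R}/\mathbb{Z}$ is identified with $[0,1)$. $dV$ is the measure given by $dV([a,b))=V(b)-V(a)$, and $L^2_V(\mathbb{T})$ is its $L^2$ space. *)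

theory Defs
  imports "HOL-Analysis.Analysis"
begin

definition cadlag :: "(real \<Rightarrow> real) \<Rightarrow> bool" where
  "cadlag F \<longleftrightarrow> (\<forall>x. continuous (at_right x) F \<and> (\<exists>l. (F \<longlongrightarrow> l) (at_left x)))"

definition caglad :: "(real \<Rightarrow> real) \<Rightarrow> bool" where
  "caglad F \<longleftrightarrow> (\<forall>x. continuous (at_left x) F \<and> (\<exists>l. (F \<longlongrightarrow> l) (at_right x)))"

text \<open>
  The library's \<^const>\<open>interval_measure\<close> charges \<open>{a<..b}\<close> and needs a right-continuous
  function. For left-continuous \<open>V\<close> we use it for the reflection \<open>x \<mapsto> - V (- x)\<close> and
  reflect back; the lemma below is the defining property.
\<close>
definition stieltjes :: "(real \<Rightarrow> real) \<Rightarrow> real measure" where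
  "stieltjes V = distr (interval_measure (\<lambda>x. - V (- x))) borel uminus"

lemma emeasure_stieltjes_Ico:
  assumes "mono V" "\<And>x. continuous (at_left x) V" "a \<le> b"
  shows "emeasure (stieltjes V) {a..<b} = ennreal (V b - V a)"
proof -
  have rc: "continuous (at_right x) (\<lambda>x. - V (- x))" for x
  proof -
    have "(V \<longlongrightarrow> V (- x)) (at_left (- x))"
      using assms(2)[of "- x"] by (simp add: continuous_within)
    then have "((\<lambda>y. V (- y)) \<longlongrightarrow> V (- x)) (at_right x)"
      by (simp add: filterlim_at_left_to_right)
    then show ?thesis
      by (simp add: continuous_within tendsto_minus)
  qed
  have "uminus -` {a..<b} = {- b<..- a}"
    by (auto simp: minus_le_iff less_minus_iff)
  then have "emeasure (stieltjes V) {a..<b}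
      = emeasure (interval_measure (\<lambda>x. - V (- x))) {- b<..- a}"
    unfolding stieltjes_def by (subst emeasure_distr) auto
  also have "\<dots> = ennreal (V b - V a)"
    using assms by (subst emeasure_interval_measure_Ioc) (auto intro: rc monoD)
  finally show ?thesis .
qed

text \<open>The torus is identified with \<open>[0,1)\<close>.\<close>
definition torus_measure :: "(real \<Rightarrow> real) \<Rightarrow> real measure" where
  "torus_measure V = restrict_space (stieltjes V) {0..<1}"

text \<open>
  Elements of the real Hilbert space \<open>L\<^sup>2(M)\<close> are given by representatives; equality in
  \<open>L\<^sup>2(M)\<close> is equality almost everywhere, and operators are required to respect it.
\<close>
definition L2 :: "'a measure \<Rightarrow> ('a \<Rightarrow> real) set" where
  "L2 M = {f \<in> borel_measurable M. integrable M (\<lambda>x. (f x)\<^sup>2)}"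

definition L2_eq :: "'a measure \<Rightarrow> ('a \<Rightarrow> real) \<Rightarrow> ('a \<Rightarrow> real) \<Rightarrow> bool" where
  "L2_eq M f g \<longleftrightarrow> (AE x in M. f x = g x)"

definition L2_inner :: "'a measure \<Rightarrow> ('a \<Rightarrow> real) \<Rightarrow> ('a \<Rightarrow> real) \<Rightarrow> real" where
  "L2_inner M f g = (\<integral>x. f x * g x \<partial>M)"

definition L2_norm :: "'a measure \<Rightarrow> ('a \<Rightarrow> real) \<Rightarrow> real" where
  "L2_norm M f = sqrt (L2_inner M f f)"

definition L2_bounded_operator :: "'a measure \<Rightarrow> (('a \<Rightarrow> real) \<Rightarrow> 'a \<Rightarrow> real) \<Rightarrow> bool" where
  "L2_bounded_operator M T \<longleftrightarrow>
     (\<forall>f\<in>L2 M. T f \<in> L2 M) \<and>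
     (\<forall>f\<in>L2 M. \<forall>g\<in>L2 M. L2_eq M f g \<longrightarrow> L2_eq M (T f) (T g)) \<and>
     (\<forall>f\<in>L2 M. \<forall>g\<in>L2 M. L2_eq M (T (\<lambda>x. f x + g x)) (\<lambda>x. T f x + T g x)) \<and>
     (\<forall>c. \<forall>f\<in>L2 M. L2_eq M (T (\<lambda>x. c * f x)) (\<lambda>x. c * T f x)) \<and>
     (\<exists>C. \<forall>f\<in>L2 M. L2_norm M (T f) \<le> C * L2_norm M f)"

definition L2_adjoint ::
    "'a measure \<Rightarrow> (('a \<Rightarrow> real) \<Rightarrow> 'a \<Rightarrow> real) \<Rightarrow> (('a \<Rightarrow> real) \<Rightarrow> 'a \<Rightarrow> real) \<Rightarrow> bool" where
  "L2_adjoint M T S \<longleftrightarrow> L2_bounded_operator M S \<and>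
     (\<forall>f\<in>L2 M. \<forall>g\<in>L2 M. L2_inner M (T f) g = L2_inner M f (S g))"

text \<open>Over the reals, self-adjointness does not follow from \<open>\<langle>P f, f\<rangle> \<ge> 0\<close>.\<close>
definition L2_positive_operator :: "'a measure \<Rightarrow> (('a \<Rightarrow> real) \<Rightarrow> 'a \<Rightarrow> real) \<Rightarrow> bool" where
  "L2_positive_operator M P \<longleftrightarrow> L2_bounded_operator M P \<and> L2_adjoint M P P \<and>
     (\<forall>f\<in>L2 M. 0 \<le> L2_inner M (P f) f)"

text \<open>\<open>P = |T|\<close>, the (unique) positive square root of \<open>T\<^sup>* T\<close>.\<close>
definition L2_abs_operator ::
    "'a measure \<Rightarrow> (('a \<Rightarrow> real) \<Rightarrow> 'a \<Rightarrow> real) \<Rightarrow> (('a \<Rightarrow> real) \<Rightarrow> 'a \<Rightarrow> real) \<Rightarrow> bool" where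
  "L2_abs_operator M T P \<longleftrightarrow> L2_positive_operator M P \<and>
     (\<exists>S. L2_adjoint M T S \<and> (\<forall>f\<in>L2 M. L2_eq M (P (P f)) (S (T f))))"

text \<open>An orthonormal basis is a complete (equivalently, maximal) orthonormal system.\<close>
definition L2_orthonormal_basis :: "'a measure \<Rightarrow> ('a \<Rightarrow> real) set \<Rightarrow> bool" where
  "L2_orthonormal_basis M E \<longleftrightarrow> E \<subseteq> L2 M \<and>
     (\<forall>e\<in>E. \<forall>e'\<in>E. L2_inner M e e' = (if e = e' then 1 else 0)) \<and>
     (\<forall>f\<in>L2 M. (\<forall>e\<in>E. L2_inner M f e = 0) \<longrightarrow> L2_eq M f (\<lambda>x. 0))"

text \<open>
  \<open>T\<close> is trace-class if \<open>\<Sum>e\<in>E. \<langle>|T| e, e\<rangle> < \<infinity>\<close> for some orthonormal basis \<open>E\<close>. The terms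
  are nonnegative and the sum does not depend on \<open>E\<close>, so ``some'' may be read as ``every''.
\<close>
definition L2_trace_class :: "'a measure \<Rightarrow> (('a \<Rightarrow> real) \<Rightarrow> 'a \<Rightarrow> real) \<Rightarrow> bool" where
  "L2_trace_class M T \<longleftrightarrow> L2_bounded_operator M T \<and>
     (\<exists>P E. L2_abs_operator M T P \<and> L2_orthonormal_basis M E \<and>
            (\<lambda>e. L2_inner M (P e) e) summable_on E)"

definition rho_W0 :: "(real \<Rightarrow> real) \<Rightarrow> real \<Rightarrow> real \<Rightarrow> real" where
  "rho_W0 W t s = W (min t s) - W t * W s / W 1"

definition K_op :: "(real \<Rightarrow> real) \<Rightarrow> (real \<Rightarrow> real) \<Rightarrow> (real \<Rightarrow> real) \<Rightarrow> real \<Rightarrow> real" where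
  "K_op W V f t = (\<integral>s. rho_W0 W t s * f s \<partial>torus_measure V)"

end

theory Submission
  imports Defs
begin

text \<open>
  The kernel of \<open>K\<close> is a Gram kernel. If \<open>dW\<close> denotes the Stieltjes measure of \<open>W\<close> on
  \<open>(0,1]\<close> and \<open>G u t = 1\<^bsub>u \<le> t\<^esub> - W t / W 1\<close>, then
  \<open>rho_W0 W t s = \<integral> G u t * G u s dW(u)\<close>; this is lemma \<open>bridge_kernel_eq_integral\<close>, and it
  says that the covariance of a bridge is obtained from the indicators of \<open>(0,t]\<close> by
  projecting away the constants in \<open>L\<^sup>2(dW)\<close>.

  Write \<open>a\<^sub>f u = \<integral> G u t * f t dV(t)\<close>. Fubini turns the bilinear form of \<open>K\<close> into
  \<open>\<langle>K f, g\<rangle> = \<integral> a\<^sub>f u * a\<^sub>g u dW(u)\<close> (lemma \<open>inner_gram_op\<close>). This is symmetric and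
  nonnegative on the diagonal, so \<open>K\<close> is positive and \<open>\<bar>K\<bar> = K\<close>. Moreover, for an
  orthonormal family \<open>F\<close>, Bessel's inequality for the function \<open>G u\<close> gives
  \<open>\<Sum>\<^sub>e (a\<^sub>e u)\<^sup>2 \<le> \<parallel>G u\<parallel>\<^sup>2\<close>; since \<open>\<bar>G u t\<bar> \<le> 1\<close>, integration over \<open>u\<close> bounds every
  finite part of the trace by \<open>V 1 * W 1\<close> (lemma \<open>sum_inner_gram_op_le\<close>). It then suffices that
  some maximal orthonormal system exists, which is an instance of Zorn's lemma.
\<close>

section \<open>Orthonormal systems of square integrable functions\<close>

lemma L2_integrable_mult:
  assumes "f \<in> L2 M" "g \<in> L2 M"
  shows "integrable M (\<lambda>x. f x * g x)"
proof (rule Bochner_Integration.integrable_bound)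
  show "integrable M (\<lambda>x. (f x)\<^sup>2 + (g x)\<^sup>2)"
    using assms by (auto simp: L2_def)
  show "(\<lambda>x. f x * g x) \<in> borel_measurable M"
    using assms by (auto simp: L2_def)
  have "\<bar>a * b\<bar> \<le> a\<^sup>2 + b\<^sup>2" for a b :: real
  proof -
    have "0 \<le> (\<bar>a\<bar> - \<bar>b\<bar>)\<^sup>2 + \<bar>a * b\<bar>"
      by simp
    then show ?thesis
      by (simp add: power2_diff abs_mult mult.assoc)
  qed
  then show "AE x in M. norm (f x * g x) \<le> norm ((f x)\<^sup>2 + (g x)\<^sup>2)"
    by simp
qed

lemma L2_add: "f \<in> L2 M \<Longrightarrow> g \<in> L2 M \<Longrightarrow> (\<lambda>x. f x + g x) \<in> L2 M"
  using L2_integrable_mult[of f M g] by (auto simp: L2_def power2_sum mult.assoc)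

lemma L2_scale: "f \<in> L2 M \<Longrightarrow> (\<lambda>x. c * f x) \<in> L2 M"
  by (auto simp: L2_def power_mult_distrib)

lemma L2_sum:
  assumes "\<And>i. i \<in> F \<Longrightarrow> f i \<in> L2 M"
  shows "(\<lambda>x. \<Sum>i\<in>F. f i x) \<in> L2 M"
  using assms
proof (induction F rule: infinite_finite_induct)
  case (insert i F)
  then show ?case by (auto intro: L2_add)
qed (auto simp: L2_def)

lemma L2_inner_commute: "L2_inner M f g = L2_inner M g f"
  by (simp add: L2_inner_def mult.commute)

lemma L2_inner_self_nonneg: "0 \<le> L2_inner M f f"
  by (simp add: L2_inner_def)

lemma L2_inner_add_left:
  "f \<in> L2 M \<Longrightarrow> g \<in> L2 M \<Longrightarrow> h \<in> L2 M \<Longrightarrow>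
    L2_inner M (\<lambda>x. f x + g x) h = L2_inner M f h + L2_inner M g h"
  by (simp add: L2_inner_def distrib_right L2_integrable_mult)

lemma L2_inner_scale_left: "L2_inner M (\<lambda>x. c * f x) h = c * L2_inner M f h"
  by (simp add: L2_inner_def mult.assoc)

lemma L2_inner_sum_left:
  assumes "\<And>i. i \<in> F \<Longrightarrow> f i \<in> L2 M" "h \<in> L2 M"
  shows "L2_inner M (\<lambda>x. \<Sum>i\<in>F. f i x) h = (\<Sum>i\<in>F. L2_inner M (f i) h)"
  using assms by (simp add: L2_inner_def sum_distrib_right L2_integrable_mult)

definition L2_orthonormal :: "'a measure \<Rightarrow> ('a \<Rightarrow> real) set \<Rightarrow> bool" where
  "L2_orthonormal M E \<longleftrightarrow> E \<subseteq> L2 M \<and>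
     (\<forall>e\<in>E. \<forall>e'\<in>E. L2_inner M e e' = (if e = e' then 1 else 0))"

text \<open>Bessel's inequality: the squared distance from \<open>g\<close> to its projection \<open>p\<close> onto the span of
  \<open>F\<close> is nonnegative, and \<open>\<langle>p, g\<rangle>\<close> and \<open>\<langle>p, p\<rangle>\<close> both equal the sum of the squared coefficients.\<close>

lemma L2_bessel:
  assumes "L2_orthonormal M F" "finite F" "g \<in> L2 M"
  shows "(\<Sum>e\<in>F. (L2_inner M g e)\<^sup>2) \<le> L2_inner M g g"
proof -
  define p where "p x = (\<Sum>e\<in>F. L2_inner M g e * e x)" for x
  define S where "S = (\<Sum>e\<in>F. (L2_inner M g e)\<^sup>2)"
  have F: "\<And>e. e \<in> F \<Longrightarrow> e \<in> L2 M"
    and ip: "\<And>e e'. e \<in> F \<Longrightarrow> e' \<in> F \<Longrightarrow> L2_inner M e e' = (if e = e' then 1 else 0)"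
    using assms(1) by (auto simp: L2_orthonormal_def)
  have p: "p \<in> L2 M"
    unfolding p_def[abs_def] by (intro L2_sum L2_scale F)
  have inner_p: "L2_inner M p h = (\<Sum>e\<in>F. L2_inner M g e * L2_inner M e h)" if "h \<in> L2 M" for h
    unfolding p_def[abs_def] using that
    by (simp add: L2_inner_sum_left L2_scale F L2_inner_scale_left)
  have pg: "L2_inner M p g = S"
    unfolding inner_p[OF assms(3)] S_def
    by (simp add: power2_eq_square L2_inner_commute[of M _ g])
  have pe: "L2_inner M e p = L2_inner M g e" if "e \<in> F" for e
  proof -
    have "L2_inner M e p = (\<Sum>e'\<in>F. L2_inner M g e' * L2_inner M e' e)"
      by (simp add: L2_inner_commute[of M e] inner_p F that)
    also have "\<dots> = (\<Sum>e'\<in>F. if e' = e then L2_inner M g e else 0)"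
      by (intro sum.cong) (auto simp: ip that)
    finally show ?thesis
      using assms(2) that by simp
  qed
  have pp: "L2_inner M p p = S"
    by (simp add: inner_p[OF p] pe S_def power2_eq_square)
  have d: "(\<lambda>x. g x + (- 1) * p x) \<in> L2 M"
    by (intro L2_add L2_scale p assms(3))
  have "0 \<le> L2_inner M (\<lambda>x. g x + (- 1) * p x) (\<lambda>x. g x + (- 1) * p x)"
    by (rule L2_inner_self_nonneg)
  also have "\<dots> = L2_inner M g g - 2 * L2_inner M p g + L2_inner M p p"
    unfolding L2_inner_add_left[OF assms(3) L2_scale[OF p] d] L2_inner_scale_left
      L2_inner_commute[of M _ "\<lambda>x. g x + (- 1) * p x"]
      L2_inner_add_left[OF assms(3) L2_scale[OF p] assms(3)] L2_inner_add_left[OF assms(3) L2_scale[OF p] p]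
    by (simp add: L2_inner_commute[of M p g])
  finally show ?thesis
    unfolding pg pp by (simp add: S_def)
qed

lemma L2_eq_zero_if_inner_self_zero:
  assumes "f \<in> L2 M" "L2_inner M f f = 0"
  shows "L2_eq M f (\<lambda>x. 0)"
proof -
  have "AE x in M. f x * f x = 0"
    using assms L2_integrable_mult[OF assms(1,1)]
    by (subst integral_nonneg_eq_0_iff_AE[symmetric]) (auto simp: L2_inner_def)
  then show ?thesis
    by (auto simp: L2_eq_def)
qed

text \<open>Completeness of a basis is expressed as maximality, so Zorn's lemma alone provides one: a
  function orthogonal to a maximal system but not null could be normalised and added to it.\<close>

lemma exists_L2_orthonormal_basis: "\<exists>E. L2_orthonormal_basis M E"
proof -
  have "\<exists>E\<in>{E. L2_orthonormal M E}. \<forall>X\<in>{E. L2_orthonormal M E}. E \<subseteq> X \<longrightarrow> X = E"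
  proof (rule subset_Zorn', clarify)
    fix C assume C: "subset.chain {E. L2_orthonormal M E} C"
    have "e \<in> L2 M" if "E \<in> C" "e \<in> E" for e E
      using C that by (auto simp: subset.chain_def L2_orthonormal_def)
    moreover have "L2_inner M e e' = (if e = e' then 1 else 0)"
      if "E \<in> C" "e \<in> E" "E' \<in> C" "e' \<in> E'" for e e' E E'
    proof -
      have "E \<subseteq> E' \<or> E' \<subseteq> E"
        using C that by (auto simp: subset_chain_def)
      with that obtain X where "X \<in> C" "e \<in> X" "e' \<in> X"
        by blast
      then show ?thesis
        using C by (auto simp: subset.chain_def L2_orthonormal_def)
    qed
    ultimately show "L2_orthonormal M (\<Union> C)"
      by (auto simp: L2_orthonormal_def)
  qed
  then obtain E where E: "L2_orthonormal M E"
    and max: "\<And>X. L2_orthonormal M X \<Longrightarrow> E \<subseteq> X \<Longrightarrow> X = E"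
    by blast
  have "L2_eq M f (\<lambda>x. 0)" if f: "f \<in> L2 M" and orth: "\<And>e. e \<in> E \<Longrightarrow> L2_inner M f e = 0" for f
  proof (rule ccontr)
    assume "\<not> L2_eq M f (\<lambda>x. 0)"
    then have pos: "0 < L2_inner M f f"
      using L2_eq_zero_if_inner_self_zero[OF f] L2_inner_self_nonneg[of M f] by fastforce
    define h where "h = (\<lambda>x. 1 / L2_norm M f * f x)"
    have h: "h \<in> L2 M"
      unfolding h_def by (rule L2_scale[OF f])
    have "L2_inner M h h = (1 / L2_norm M f) * L2_inner M h f"
      by (subst h_def) (simp only: L2_inner_scale_left L2_inner_commute[of M f h])
    also have "\<dots> = (1 / L2_norm M f) * ((1 / L2_norm M f) * L2_inner M f f)"
      by (simp only: h_def L2_inner_scale_left)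
    also have "\<dots> = 1"
      using pos by (simp add: L2_norm_def)
    finally have hh: "L2_inner M h h = 1" .
    have he: "L2_inner M h e = 0" if "e \<in> E" for e
      unfolding h_def L2_inner_scale_left using orth[OF that] by simp
    then have eh: "L2_inner M e h = 0" if "e \<in> E" for e
      using that by (simp only: L2_inner_commute[of M e h])
    have "L2_orthonormal M (insert h E)"
      using E h hh he eh by (auto simp: L2_orthonormal_def)
    then have "h \<in> E"
      using max by blast
    then show False
      using he hh by fastforce
  qed
  with E have "L2_orthonormal_basis M E"
    by (simp add: L2_orthonormal_basis_def L2_orthonormal_def)
  then show ?thesis ..
qed

section \<open>Gram kernels\<close>

lemma (in finite_measure) L2_integrable:
  assumes "f \<in> L2 M"
  shows "integrable M f"
proof -
  have "(\<lambda>x. 1) \<in> L2 M"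
    by (simp add: L2_def)
  from L2_integrable_mult[OF assms this] show ?thesis
    by simp
qed

lemma (in finite_measure) L2_if_bounded:
  assumes "f \<in> borel_measurable M" "\<And>x. x \<in> space M \<Longrightarrow> \<bar>f x\<bar> \<le> C"
  shows "f \<in> L2 M"
proof -
  have "integrable M (\<lambda>x. (f x)\<^sup>2)"
  proof (rule integrable_const_bound[where B = "C\<^sup>2"])
    show "AE x in M. norm ((f x)\<^sup>2) \<le> C\<^sup>2"
    proof (rule AE_I2)
      fix x assume "x \<in> space M"
      from assms(2)[OF this] have "\<bar>f x\<bar> \<le> \<bar>C\<bar>"
        by linarith
      then show "norm ((f x)\<^sup>2) \<le> C\<^sup>2"
        by (simp add: abs_le_square_iff)
    qed
  qed (use assms(1) in simp)
  with assms(1) show ?thesis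
    by (simp add: L2_def)
qed

text \<open>A Cauchy-Schwarz estimate, obtained from the nonnegativity of \<open>\<integral> (m * \<bar>f\<bar> - c)\<^sup>2\<close> with
  \<open>c = \<integral> \<bar>f\<bar>\<close>. With \<open>m\<close> at least the total mass this yields \<open>c\<^sup>2 \<le> m * \<integral> f\<^sup>2\<close>; the summand 1
  covers the null measure and allows \<open>sqrt m\<close> to be replaced by \<open>m\<close>.\<close>

lemma (in finite_measure) integral_abs_le_L2_norm:
  assumes "f \<in> L2 M"
  shows "(\<integral>x. \<bar>f x\<bar> \<partial>M) \<le> (measure M (space M) + 1) * L2_norm M f"
proof -
  define m where "m = measure M (space M) + 1"
  define c where "c = (\<integral>x. \<bar>f x\<bar> \<partial>M)"
  define I where "I = L2_inner M f f"
  have m: "1 \<le> m" and measure_space: "measure M (space M) = m - 1"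
    by (simp_all add: m_def)
  have int: "integrable M f" "integrable M (\<lambda>x. (f x)\<^sup>2)"
    using L2_integrable[OF assms] assms by (auto simp: L2_def)
  have "0 \<le> (\<integral>x. (m * \<bar>f x\<bar> - c)\<^sup>2 \<partial>M)"
    by simp
  also have "\<dots> = (\<integral>x. m\<^sup>2 * (f x)\<^sup>2 - (2 * m * c) * \<bar>f x\<bar> + c\<^sup>2 \<partial>M)"
    by (intro Bochner_Integration.integral_cong) (auto simp: power2_diff power_mult_distrib)
  also have "\<dots> = m\<^sup>2 * I - (2 * m * c) * c + c\<^sup>2 * (m - 1)"
  proof -
    have "(\<integral>x. (f x)\<^sup>2 \<partial>M) = I"
      unfolding I_def L2_inner_def power2_eq_square ..
    then show ?thesis
      using int by (simp add: c_def[symmetric] measure_space mult.commute)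
  qed
  also have "\<dots> \<le> m\<^sup>2 * I - m * c\<^sup>2"
  proof -
    have "0 \<le> c\<^sup>2" by simp
    then show ?thesis by (simp add: algebra_simps power2_eq_square)
  qed
  finally have "m * c\<^sup>2 \<le> m\<^sup>2 * I"
    by simp
  moreover have "c\<^sup>2 \<le> m * c\<^sup>2"
    using m mult_right_mono[of 1 m "c\<^sup>2"] by simp
  ultimately have "c\<^sup>2 \<le> (m * sqrt I)\<^sup>2"
    by (simp add: power_mult_distrib I_def L2_inner_self_nonneg)
  then have "c \<le> m * sqrt I"
    by (rule power2_le_imp_le) (use m in \<open>simp add: I_def L2_inner_self_nonneg\<close>)
  then show ?thesis
    by (simp add: c_def I_def L2_norm_def m_def)
qed

text \<open>The kernel \<open>k\<close> is prescribed only on the space of \<open>M\<close>: an explicit formula for a kernel need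
  not agree with the Gram integral elsewhere.\<close>

locale bounded_gram_kernel = M: finite_measure M + N: finite_measure N
  for M :: "'a measure" and N :: "'b measure" +
  fixes G :: "'b \<Rightarrow> 'a \<Rightarrow> real" and B :: real and k :: "'a \<Rightarrow> 'a \<Rightarrow> real"
  assumes G_measurable: "(\<lambda>(u, t). G u t) \<in> borel_measurable (N \<Otimes>\<^sub>M M)"
    and G_bound: "\<And>u t. u \<in> space N \<Longrightarrow> t \<in> space M \<Longrightarrow> \<bar>G u t\<bar> \<le> B"
    and B_nonneg: "0 \<le> B"
    and kernel: "\<And>t s. t \<in> space M \<Longrightarrow> s \<in> space M \<Longrightarrow> k t s = (\<integral>u. G u t * G u s \<partial>N)"
begin

sublocale NM: pair_sigma_finite N M ..

definition gram_op :: "('a \<Rightarrow> real) \<Rightarrow> 'a \<Rightarrow> real" where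
  "gram_op f t = (\<integral>s. k t s * f s \<partial>M)"

definition coeff :: "('a \<Rightarrow> real) \<Rightarrow> 'b \<Rightarrow> real" where
  "coeff f u = L2_inner M (G u) f"

lemma G_measurable_comp [measurable (raw)]:
  assumes [measurable]: "a \<in> measurable L N" "b \<in> measurable L M"
  shows "(\<lambda>x. G (a x) (b x)) \<in> borel_measurable L"
proof -
  have "(\<lambda>x. (case (a x, b x) of (u, t) \<Rightarrow> G u t)) \<in> borel_measurable L"
    by (rule measurable_compose[OF _ G_measurable]) measurable
  then show ?thesis by simp
qed

lemma G_in_L2: "u \<in> space N \<Longrightarrow> G u \<in> L2 M"
  by (rule M.L2_if_bounded[where C = B]) (auto intro: G_bound)

text \<open>This justifies both exchanges of integrals below: there the integrand is a bounded factor
  times a square integrable, hence integrable, function of the second variable.\<close>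

lemma integrable_product_if_dominated:
  fixes H :: "'b \<Rightarrow> 'a \<Rightarrow> real"
  assumes [measurable]: "(\<lambda>(u, s). H u s) \<in> borel_measurable (N \<Otimes>\<^sub>M M)"
    and h: "integrable M h"
    and le: "\<And>u s. u \<in> space N \<Longrightarrow> s \<in> space M \<Longrightarrow> \<bar>H u s\<bar> \<le> h s"
  shows "integrable (N \<Otimes>\<^sub>M M) (\<lambda>(u, s). H u s)"
proof -
  have sec: "integrable M (H u)" if "u \<in> space N" for u
  proof (rule Bochner_Integration.integrable_bound[OF h])
    show "H u \<in> borel_measurable M"
      using that by measurable
    show "AE s in M. norm (H u s) \<le> norm (h s)"
      using le[OF that] by (intro AE_I2) fastforce
  qed
  show ?thesis
  proof (rule NM.Fubini_integrable)
    show "AE u in N. integrable M (\<lambda>s. case (u, s) of (u, s) \<Rightarrow> H u s)"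
      using sec by (intro AE_I2) simp
    show "integrable N (\<lambda>u. \<integral>s. norm (case (u, s) of (u, s) \<Rightarrow> H u s) \<partial>M)"
    proof (rule N.integrable_const_bound[where B = "\<integral>s. h s \<partial>M"])
      show "AE u in N. norm (\<integral>s. norm (case (u, s) of (u, s) \<Rightarrow> H u s) \<partial>M) \<le> (\<integral>s. h s \<partial>M)"
        using sec le h by (intro AE_I2) (auto intro!: integral_mono)
    qed measurable
  qed fact
qed

lemma coeff_measurable:
  assumes [measurable]: "f \<in> borel_measurable M"
  shows "coeff f \<in> borel_measurable N"
  unfolding coeff_def[abs_def] L2_inner_def by measurable

lemma coeff_bound:
  assumes "f \<in> L2 M" "u \<in> space N"
  shows "\<bar>coeff f u\<bar> \<le> B * (\<integral>s. \<bar>f s\<bar> \<partial>M)"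
proof -
  have f: "integrable M f"
    using assms(1) by (rule M.L2_integrable)
  have "\<bar>coeff f u\<bar> \<le> (\<integral>s. \<bar>G u s * f s\<bar> \<partial>M)"
    unfolding coeff_def L2_inner_def by (rule integral_abs_bound)
  also have "\<dots> \<le> (\<integral>s. B * \<bar>f s\<bar> \<partial>M)"
    using assms f L2_integrable_mult[OF G_in_L2[OF assms(2)] assms(1)]
    by (intro integral_mono integrable_abs) (auto simp: abs_mult intro: mult_right_mono G_bound)
  finally show ?thesis by simp
qed

lemma coeff_mult_integrable:
  assumes "f \<in> L2 M" "g \<in> L2 M"
  shows "integrable N (\<lambda>u. coeff f u * coeff g u)"
proof (rule N.integrable_const_bound)
  show "(\<lambda>u. coeff f u * coeff g u) \<in> borel_measurable N"
    using assms by (auto intro!: borel_measurable_times coeff_measurable simp: L2_def)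
  show "AE u in N. norm (coeff f u * coeff g u)
      \<le> (B * (\<integral>s. \<bar>f s\<bar> \<partial>M)) * (B * (\<integral>s. \<bar>g s\<bar> \<partial>M))"
    using assms B_nonneg
    by (intro AE_I2) (auto simp: abs_mult intro!: mult_mono coeff_bound)
qed

text \<open>The factorisation of the operator through \<open>L\<^sup>2(N)\<close>: it is the coefficient map followed by
  its transpose. Measurability, linearity and boundedness are read off from this form.\<close>

lemma gram_op_eq_integral_coeff:
  assumes f: "f \<in> L2 M" and t: "t \<in> space M"
  shows "gram_op f t = (\<integral>u. G u t * coeff f u \<partial>N)"
proof -
  have [measurable]: "f \<in> borel_measurable M"
    using f by (simp add: L2_def)
  have int: "integrable (N \<Otimes>\<^sub>M M) (\<lambda>(u, s). G u t * G u s * f s)"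
  proof (rule integrable_product_if_dominated)
    show "integrable M (\<lambda>s. B * B * \<bar>f s\<bar>)"
      using M.L2_integrable[OF f] by simp
    show "\<bar>G u t * G u s * f s\<bar> \<le> B * B * \<bar>f s\<bar>" if "u \<in> space N" "s \<in> space M" for u s
      using that t B_nonneg by (auto simp: abs_mult intro!: mult_mono G_bound)
  qed (use t in measurable)
  have "gram_op f t = (\<integral>s. (\<integral>u. G u t * G u s * f s \<partial>N) \<partial>M)"
    unfolding gram_op_def using t by (intro Bochner_Integration.integral_cong) (auto simp: kernel)
  also have "\<dots> = (\<integral>u. (\<integral>s. G u t * G u s * f s \<partial>M) \<partial>N)"
    by (rule NM.Fubini_integral[OF int])
  also have "\<dots> = (\<integral>u. G u t * coeff f u \<partial>N)"
    by (simp add: coeff_def L2_inner_def mult.assoc)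
  finally show ?thesis .
qed

lemma gram_op_bound:
  assumes f: "f \<in> L2 M" and t: "t \<in> space M"
  shows "\<bar>gram_op f t\<bar> \<le> B\<^sup>2 * measure N (space N) * (\<integral>s. \<bar>f s\<bar> \<partial>M)"
proof -
  have le: "\<bar>G u t * coeff f u\<bar> \<le> B * (B * (\<integral>s. \<bar>f s\<bar> \<partial>M))" if "u \<in> space N" for u
    using that t f B_nonneg by (auto simp: abs_mult intro!: mult_mono G_bound coeff_bound)
  have [measurable]: "coeff f \<in> borel_measurable N"
    using f by (auto simp: L2_def intro: coeff_measurable)
  have "\<bar>gram_op f t\<bar> \<le> (\<integral>u. \<bar>G u t * coeff f u\<bar> \<partial>N)"
    unfolding gram_op_eq_integral_coeff[OF assms] by (rule integral_abs_bound)
  also have "\<dots> \<le> (\<integral>u. B * (B * (\<integral>s. \<bar>f s\<bar> \<partial>M)) \<partial>N)"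
  proof (rule integral_mono)
    show "integrable N (\<lambda>u. \<bar>G u t * coeff f u\<bar>)"
      using le t by (intro N.integrable_const_bound[where B = "B * (B * (\<integral>s. \<bar>f s\<bar> \<partial>M))"]) auto
  qed (use le in auto)
  finally show ?thesis
    by (simp add: power2_eq_square mult_ac)
qed

lemma gram_op_in_L2:
  assumes "f \<in> L2 M"
  shows "gram_op f \<in> L2 M"
proof (rule M.L2_if_bounded)
  have [measurable]: "f \<in> borel_measurable M" "coeff f \<in> borel_measurable N"
    using assms by (auto simp: L2_def intro: coeff_measurable)
  have "(\<lambda>t. \<integral>u. G u t * coeff f u \<partial>N) \<in> borel_measurable M"
    by measurable
  then show "gram_op f \<in> borel_measurable M"
    by (subst measurable_cong[OF gram_op_eq_integral_coeff[OF assms]]) auto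
qed (rule gram_op_bound[OF assms])

text \<open>A second exchange of integrals moves the transpose to the other argument. Symmetry and
  positivity are visible in the resulting formula.\<close>

lemma inner_gram_op:
  assumes f: "f \<in> L2 M" and g: "g \<in> L2 M"
  shows "L2_inner M (gram_op f) g = (\<integral>u. coeff f u * coeff g u \<partial>N)"
proof -
  have [measurable]: "f \<in> borel_measurable M" "g \<in> borel_measurable M" "coeff f \<in> borel_measurable N"
    using f g by (auto simp: L2_def intro: coeff_measurable)
  define C where "C = B * (\<integral>s. \<bar>f s\<bar> \<partial>M)"
  have int: "integrable (N \<Otimes>\<^sub>M M) (\<lambda>(u, t). coeff f u * G u t * g t)"
  proof (rule integrable_product_if_dominated)
    show "integrable M (\<lambda>t. C * B * \<bar>g t\<bar>)"
      using M.L2_integrable[OF g] by simp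
    show "\<bar>coeff f u * G u t * g t\<bar> \<le> C * B * \<bar>g t\<bar>" if "u \<in> space N" "t \<in> space M" for u t
      using that B_nonneg f unfolding C_def
      by (auto simp: abs_mult intro!: mult_mono G_bound coeff_bound)
  qed measurable
  have "L2_inner M (gram_op f) g = (\<integral>t. (\<integral>u. coeff f u * G u t * g t \<partial>N) \<partial>M)"
    unfolding L2_inner_def
    by (intro Bochner_Integration.integral_cong) (auto simp: gram_op_eq_integral_coeff f mult_ac)
  also have "\<dots> = (\<integral>u. (\<integral>t. coeff f u * G u t * g t \<partial>M) \<partial>N)"
    by (rule NM.Fubini_integral[OF int])
  also have "\<dots> = (\<integral>u. coeff f u * coeff g u \<partial>N)"
    by (simp add: coeff_def L2_inner_def mult.assoc)
  finally show ?thesis .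
qed

lemma gram_op_bounded_operator: "L2_bounded_operator M gram_op"
  unfolding L2_bounded_operator_def
proof (intro conjI ballI allI impI)
  fix f assume f: "f \<in> L2 M"
  then show "gram_op f \<in> L2 M"
    by (rule gram_op_in_L2)
  fix c
  show "L2_eq M (gram_op (\<lambda>x. c * f x)) (\<lambda>x. c * gram_op f x)"
  proof -
    have "coeff (\<lambda>x. c * f x) u = c * coeff f u" for u
      by (simp only: coeff_def L2_inner_commute[of M "G u"] L2_inner_scale_left)
    then show ?thesis
      using f unfolding L2_eq_def
      by (intro AE_I2) (simp add: gram_op_eq_integral_coeff L2_scale mult.left_commute[of _ c])
  qed
next
  fix f g assume f: "f \<in> L2 M" and g: "g \<in> L2 M"
  have c: "coeff h \<in> L2 N" if "h \<in> L2 M" for h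
    using that by (intro N.L2_if_bounded[OF coeff_measurable coeff_bound]) (auto simp: L2_def)
  have int: "integrable N (\<lambda>u. G u t * coeff h u)" if "h \<in> L2 M" "t \<in> space M" for h t
  proof (rule L2_integrable_mult[OF _ c])
    show "(\<lambda>u. G u t) \<in> L2 N"
      using that by (intro N.L2_if_bounded[where C = B]) (auto intro: G_bound)
  qed fact
  show "L2_eq M (gram_op (\<lambda>x. f x + g x)) (\<lambda>x. gram_op f x + gram_op g x)"
    unfolding L2_eq_def
  proof (rule AE_I2)
    fix t assume t: "t \<in> space M"
    have "gram_op (\<lambda>x. f x + g x) t = (\<integral>u. G u t * coeff f u + G u t * coeff g u \<partial>N)"
      unfolding gram_op_eq_integral_coeff[OF L2_add[OF f g] t]
    proof (rule Bochner_Integration.integral_cong[OF refl])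
      fix u assume "u \<in> space N"
      then show "G u t * coeff (\<lambda>x. f x + g x) u = G u t * coeff f u + G u t * coeff g u"
        by (simp add: coeff_def L2_inner_commute[of M "G u"] L2_inner_add_left f g G_in_L2
            distrib_left)
    qed
    then show "gram_op (\<lambda>x. f x + g x) t = gram_op f t + gram_op g t"
      using int f g t by (simp add: gram_op_eq_integral_coeff)
  qed
  assume "L2_eq M f g"
  then have "coeff f u = coeff g u" if "u \<in> space N" for u
    unfolding coeff_def L2_inner_def using f g that G_in_L2[OF that]
    by (intro integral_cong_AE) (auto simp: L2_def L2_eq_def)
  then have "gram_op f t = gram_op g t" if "t \<in> space M" for t
    using that f g by (simp add: gram_op_eq_integral_coeff cong: Bochner_Integration.integral_cong)
  then show "L2_eq M (gram_op f) (gram_op g)"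
    by (simp add: L2_eq_def)
next
  define m where "m = measure M (space M) + 1"
  define D where "D = B\<^sup>2 * measure N (space N) * m"
  have "L2_norm M (gram_op f) \<le> (m * D) * L2_norm M f" if f: "f \<in> L2 M" for f
  proof -
    have D: "0 \<le> D" and m: "1 \<le> m" and n: "0 \<le> L2_norm M f"
      by (auto simp: D_def m_def L2_norm_def L2_inner_self_nonneg)
    have pt: "\<bar>gram_op f t\<bar> \<le> D * L2_norm M f" if "t \<in> space M" for t
    proof -
      have "\<bar>gram_op f t\<bar> \<le> B\<^sup>2 * measure N (space N) * (\<integral>s. \<bar>f s\<bar> \<partial>M)"
        by (rule gram_op_bound[OF f that])
      also have "\<dots> \<le> B\<^sup>2 * measure N (space N) * (m * L2_norm M f)"
        unfolding m_def by (intro mult_left_mono M.integral_abs_le_L2_norm f) auto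
      finally show ?thesis
        by (simp add: D_def mult_ac)
    qed
    have "L2_inner M (gram_op f) (gram_op f) \<le> (\<integral>t. (D * L2_norm M f)\<^sup>2 \<partial>M)"
      unfolding L2_inner_def
    proof (rule integral_mono)
      fix t assume "t \<in> space M"
      from pt[OF this] have "\<bar>gram_op f t\<bar> \<le> \<bar>D * L2_norm M f\<bar>" by simp
      then show "gram_op f t * gram_op f t \<le> (D * L2_norm M f)\<^sup>2"
        by (simp only: abs_le_square_iff power2_eq_square)
    qed (auto intro: L2_integrable_mult gram_op_in_L2 f)
    also have "\<dots> = (m - 1) * (D * L2_norm M f)\<^sup>2"
      by (simp add: m_def)
    \<comment> \<open>A crude bound for the total mass, chosen so that the square root below is exact.\<close>
    also have "\<dots> \<le> m\<^sup>2 * (D * L2_norm M f)\<^sup>2"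
    proof (rule mult_right_mono)
      have "m * 1 \<le> m * m"
        using m by (intro mult_left_mono) auto
      then show "m - 1 \<le> m\<^sup>2"
        unfolding power2_eq_square by linarith
    qed simp
    finally have "L2_norm M (gram_op f) \<le> sqrt ((m * (D * L2_norm M f))\<^sup>2)"
      unfolding L2_norm_def[of M "gram_op f"] by (simp add: power_mult_distrib)
    then show ?thesis
      using D m n by (simp add: mult.assoc)
  qed
  then show "\<exists>C. \<forall>f\<in>L2 M. L2_norm M (gram_op f) \<le> C * L2_norm M f"
    by blast
qed

text \<open>A positive operator is its own absolute value: with itself as adjoint, both sides of
  \<open>P\<^sup>2 = T\<^sup>* T\<close> are the square of the operator.\<close>

lemma gram_op_abs_operator: "L2_abs_operator M gram_op gram_op"
proof -
  have adj: "L2_adjoint M gram_op gram_op"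
    unfolding L2_adjoint_def
  proof (intro conjI ballI gram_op_bounded_operator)
    fix f g assume "f \<in> L2 M" "g \<in> L2 M"
    then show "L2_inner M (gram_op f) g = L2_inner M f (gram_op g)"
      by (simp add: L2_inner_commute[of M f] inner_gram_op mult.commute)
  qed
  moreover have "0 \<le> L2_inner M (gram_op f) f" if "f \<in> L2 M" for f
    using that by (simp add: inner_gram_op)
  ultimately show ?thesis
    unfolding L2_abs_operator_def L2_positive_operator_def
    by (auto simp: gram_op_bounded_operator L2_eq_def)
qed

text \<open>The bound does not depend on \<open>F\<close>, because for each \<open>u\<close> Bessel's inequality controls the sum
  of the squared coefficients by the squared norm of \<open>G u\<close>.\<close>

lemma sum_inner_gram_op_le:
  assumes F: "L2_orthonormal M F" and fin: "finite F"
  shows "(\<Sum>e\<in>F. L2_inner M (gram_op e) e) \<le> B\<^sup>2 * measure M (space M) * measure N (space N)"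
proof -
  have L2: "\<And>e. e \<in> F \<Longrightarrow> e \<in> L2 M"
    using F by (auto simp: L2_orthonormal_def)
  have "(\<Sum>e\<in>F. L2_inner M (gram_op e) e) = (\<integral>u. (\<Sum>e\<in>F. coeff e u * coeff e u) \<partial>N)"
    by (simp add: inner_gram_op L2 coeff_mult_integrable)
  also have "\<dots> \<le> (\<integral>u. B\<^sup>2 * measure M (space M) \<partial>N)"
  proof (rule integral_mono)
    fix u assume u: "u \<in> space N"
    have "(\<Sum>e\<in>F. coeff e u * coeff e u) \<le> L2_inner M (G u) (G u)"
      using L2_bessel[OF F fin G_in_L2[OF u]] by (simp add: coeff_def power2_eq_square)
    also have "\<dots> \<le> (\<integral>t. B\<^sup>2 \<partial>M)"
      unfolding L2_inner_def
    proof (rule integral_mono)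
      fix t assume "t \<in> space M"
      with u have "\<bar>G u t\<bar> \<le> \<bar>B\<bar>" using G_bound[of u t] by simp
      then show "G u t * G u t \<le> B\<^sup>2"
        by (simp only: abs_le_square_iff power2_eq_square)
    qed (auto intro: L2_integrable_mult G_in_L2 u)
    finally show "(\<Sum>e\<in>F. coeff e u * coeff e u) \<le> B\<^sup>2 * measure M (space M)"
      by (simp add: mult.commute)
  qed (auto intro!: Bochner_Integration.integrable_sum coeff_mult_integrable L2)
  finally show ?thesis
    by (simp add: mult_ac)
qed

theorem gram_op_trace_class: "L2_trace_class M gram_op"
proof -
  obtain E where E: "L2_orthonormal_basis M E"
    using exists_L2_orthonormal_basis by blast
  then have on: "L2_orthonormal M F" if "F \<subseteq> E" for F
    using that by (auto simp: L2_orthonormal_basis_def L2_orthonormal_def subset_iff)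
  have "(\<lambda>e. L2_inner M (gram_op e) e) summable_on E"
  proof (rule nonneg_bdd_above_summable_on)
    show "0 \<le> L2_inner M (gram_op e) e" if "e \<in> E" for e
      using E that by (auto simp: L2_orthonormal_basis_def inner_gram_op)
    show "bdd_above (sum (\<lambda>e. L2_inner M (gram_op e) e) ` {F. F \<subseteq> E \<and> finite F})"
      using sum_inner_gram_op_le on by (intro bdd_aboveI2) auto
  qed
  with E show ?thesis
    unfolding L2_trace_class_def using gram_op_bounded_operator gram_op_abs_operator by blast
qed

end

section \<open>The bridge kernel\<close>

lemma finite_measure_torus_measure:
  assumes "mono V" "caglad V"
  shows "finite_measure (torus_measure V)"
proof (rule finite_measureI)
  have "sets (stieltjes V) = sets borel"
    by (simp add: stieltjes_def)
  then have "emeasure (torus_measure V) (space (torus_measure V)) = emeasure (stieltjes V) {0..<1}"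
    unfolding torus_measure_def by (subst emeasure_restrict_space) (auto simp: space_restrict_space dest: sets_eq_imp_space_eq)
  also have "\<dots> = ennreal (V 1 - V 0)"
    using assms by (intro emeasure_stieltjes_Ico) (auto simp: caglad_def)
  finally show "emeasure (torus_measure V) (space (torus_measure V)) \<noteq> \<infinity>"
    by simp
qed

text \<open>Under \<open>dW\<close> on \<open>(0,1]\<close> the indicator of \<open>(0,r]\<close> has integral \<open>W r\<close>, and the product of two
  such indicators is the one for the minimum. Multiplying out the product, each of the two cross
  terms contributes \<open>- W t * W s / W 1\<close> and the constant term gives one of them back.\<close>

lemma bridge_kernel_eq_integral:
  fixes W :: "real \<Rightarrow> real"
  assumes W: "mono W" "\<And>x. continuous (at_right x) W" "W 0 = 0" "W 1 \<noteq> 0"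
    and t: "t \<in> {0..1}" and s: "s \<in> {0..1}"
  defines "N \<equiv> restrict_space (interval_measure W) {0<..1}"
  defines "G \<equiv> \<lambda>u t. indicator {..t} u - W t / W 1"
  shows "rho_W0 W t s = (\<integral>u. G u t * G u s \<partial>N)"
proof -
  have emeas: "emeasure N {0<..r} = ennreal (W r)" if "r \<in> {0..1}" for r
    using that W unfolding N_def
    by (subst emeasure_restrict_space) (auto simp: emeasure_interval_measure_Ioc monoD)
  have space_N: "space N = {0<..1}"
    by (simp add: N_def space_restrict_space)
  have pos: "0 \<le> W r" if "r \<in> {0..1}" for r
    using that W monoD[of W 0 r] by simp
  have "finite_measure N"
    by (rule finite_measureI) (simp add: space_N emeas)
  then interpret N: finite_measure N .
  have mW: "measure N (space N) = W 1"
    by (simp add: space_N measure_def emeas pos)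
  have set_N: "{..r} \<inter> space N \<in> sets N" for r
    by (auto simp: space_N N_def sets_restrict_space Int_commute)
  have ind: "integrable N (\<lambda>u. indicator {..r} u :: real)"
      "(\<integral>u. indicator {..r} u \<partial>N) = W r" if "r \<in> {0..1}" for r
  proof -
    have eq: "{..r} \<inter> space N = {0<..r}"
      using that by (auto simp: space_N)
    then show "(\<integral>u. indicator {..r} u \<partial>N) = W r"
      using that set_N[of r] by (simp add: measure_def emeas pos)
    show "integrable N (\<lambda>u. indicator {..r} u :: real)"
      using set_N[of r] by (simp add: integrable_indicator_iff N.emeasure_eq_measure)
  qed
  have min: "min t s \<in> {0..1}"
    using t s by auto
  have "(\<integral>u. G u t * G u s \<partial>N)
      = (\<integral>u. indicator {..min t s} u - W s / W 1 * indicator {..t} u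
            - W t / W 1 * indicator {..s} u + W t / W 1 * (W s / W 1) \<partial>N)"
    unfolding G_def by (intro Bochner_Integration.integral_cong) (auto simp: indicator_def algebra_simps)
  also have "\<dots> = W (min t s) - W s / W 1 * W t - W t / W 1 * W s + W t / W 1 * (W s / W 1) * W 1"
    using ind[OF t] ind[OF s] ind[OF min] by (simp add: mW)
  also have "\<dots> = rho_W0 W t s"
    using W(4) by (simp add: rho_W0_def field_simps)
  finally show ?thesis ..
qed

theorem proposition16:
  fixes W V :: "real \<Rightarrow> real"
  assumes "strict_mono W" "strict_mono V"
    and "cadlag W" "caglad V"
    and "\<And>x. W (x + 1) - W x = W 1 - W 0"
    and "\<And>x. V (x + 1) - V x = V 1 - V 0"
    and "isCont W 0" "isCont V 0"
    and "W 0 = 0" "V 0 = 0"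
  shows "L2_trace_class (torus_measure V) (K_op W V)"
proof -
  define N where "N = restrict_space (interval_measure W) {0<..1}"
  define G :: "real \<Rightarrow> real \<Rightarrow> real" where "G = (\<lambda>u t. indicator {..t} u - W t / W 1)"
  have mono: "mono W" "mono V"
    using assms(1,2) by (auto intro: strict_mono_mono)
  have rc: "\<And>x. continuous (at_right x) W"
    using assms(3) by (simp add: cadlag_def)
  have W1: "0 < W 1"
    using assms(1,9) strict_monoD[of W 0 1] by simp
  have space_M: "space (torus_measure V) = {0..<1}"
    by (simp add: torus_measure_def stieltjes_def space_restrict_space)
  have space_N: "space N = {0<..1}"
    by (simp add: N_def space_restrict_space)
  interpret bounded_gram_kernel "torus_measure V" N G 1 "rho_W0 W"
  proof (intro bounded_gram_kernel.intro bounded_gram_kernel_axioms.intro)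
    show "finite_measure (torus_measure V)"
      using mono assms(4) by (intro finite_measure_torus_measure)
    show "finite_measure N"
    proof (rule finite_measureI)
      show "emeasure N (space N) \<noteq> \<infinity>"
        unfolding space_N unfolding N_def using mono rc
        by (subst emeasure_restrict_space) (auto simp: emeasure_interval_measure_Ioc monoD)
    qed
    have [measurable]: "W \<in> borel_measurable borel"
      using mono(1) by (rule borel_measurable_mono)
    have [measurable]: "(\<lambda>x. x) \<in> borel_measurable N" "(\<lambda>x. x) \<in> borel_measurable (torus_measure V)"
      by (auto simp: N_def torus_measure_def stieltjes_def intro!: measurable_restrict_space1)
    have [measurable]: "fst \<in> borel_measurable (N \<Otimes>\<^sub>M torus_measure V)"
      "snd \<in> borel_measurable (N \<Otimes>\<^sub>M torus_measure V)"
      by (auto intro: measurable_compose[OF measurable_fst] measurable_compose[OF measurable_snd])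
    have "(\<lambda>p. (if fst p \<le> snd p then 1 else 0) - W (snd p) / W 1)
        \<in> borel_measurable (N \<Otimes>\<^sub>M torus_measure V)"
      by measurable
    then show "(\<lambda>(u, t). G u t) \<in> borel_measurable (N \<Otimes>\<^sub>M torus_measure V)"
      by (simp add: G_def indicator_def case_prod_beta)
    fix t assume t: "t \<in> space (torus_measure V)"
    have "0 \<le> W t" "W t \<le> W 1"
      using t mono assms(9) monoD[of W 0 t] monoD[of W t 1] by (auto simp: space_M)
    then have "0 \<le> W t / W 1" "W t / W 1 \<le> 1"
      using W1 by auto
    then show "\<bar>G u t\<bar> \<le> 1" for u
      by (auto simp: G_def indicator_def)
    fix s assume s: "s \<in> space (torus_measure V)"
    show "rho_W0 W t s = (\<integral>u. G u t * G u s \<partial>N)"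
      unfolding G_def N_def using t s mono rc assms(9) W1
      by (intro bridge_kernel_eq_integral) (auto simp: space_M)
  qed simp
  have "K_op W V = gram_op"
    by (intro ext) (simp add: K_op_def gram_op_def)
  then show ?thesis
    using gram_op_trace_class by simp
qed

end
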